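(* Let $G=(V,E)$ be a connected simple graph with $|V|>2$, and for integers $k>2$ and $1\le s<\frac{k}{2}$ let $\mathscr{B}^{k,s}$ be the quotient tensor of the signless Laplacian tensor $\mathscr{Q}^{k,s}$ of the generalized power hypergraph $G^{k,s}$. Then $\lambda(\mathscr{B}^{k,s})=\lambda(\mathscr{Q}^{k,s})$, and for fixed $s$ this common value is strictly decreasing with respect to $k$.
   Context: Generalized power hypergraph: for a simple graph $G=(V,E)$, an integer $k\ge2$ and $1\le s\le k/2$, $G^{k,s}$ is the $k$-uniform hypergraph obtained by taking, for each $v\in V$, a set $V_v$ of $s$ new vertices and, for each $e\in E$, a set $V_e$ of $k-2s$ new vertices (all pairwise disjoint), with vertex set $V^{k,s}=\bigcup_vV_v\cup\bigcup_eV_e$ and edge set $\{V_u\cup V_v\cup V_e:e=uv\in E\}$. Its adjacency tensor $\mathscr{A}^{k,s}$ is the order $k$ tensor indexed by $V^{k,s}$ with entry $\frac1{(k-1)!}$ at $(i_1,\dots,i_k)$ if $\{i_1,\dots,i_k\}$ is an edge and $0$ otherwise; the signless Laplacian tensor is $\mathscr{Q}^{k,s}=\mathscr{D}^{k,s}+\mathscr{A}^{k,s}$ with $\mathscr{D}^{k,s}$ the diagonal tensor of vertex degrees. For $s<k/2$, $\mathscr{B}^{k,s}$ is the quotient tensor of $\mathscr{Q}^{k,s}$ with respect to the partition $\{V_e,V_v:e\in E,v\in V\}$: the order $k$ tensor indexed by $E\cup V$ with entries $b_{ii_2\cdots i_k}=\frac1{|V_i|}\sum_{j\in V_i}\sum_{j_2\in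 V_{i_2},\dots,j_k\in V_{i_k}}(\mathscr{Q}^{k,s})_{jj_2\cdots j_k}$. For an order $k$ tensor $\mathscr{T}$ indexed by a finite set $N$, $(\mathscr{T}x)_i=\sum_{i_2,\dots,i_k}t_{ii_2\cdots i_k}x_{i_2}\cdots x_{i_k}$; $\lambda\in\mathbb{R}$ is an $H$-eigenvalue if $\mathscr{T}x=\lambda x^{[k-1]}$ for some nonzero real $x$ (with $x^{[k-1]}_i=x_i^{k-1}$); $\lambda(\mathscr{T})$ is the largest $H$-eigenvalue. *)

theory Defs
  imports Complex_Main
begin

definition simple_graph :: "'a set \<Rightarrow> 'a set set \<Rightarrow> bool" where
  "simple_graph V E \<longleftrightarrow> finite V \<and> (\<forall>e\<in>E. e \<subseteq> V \<and> card e = 2)"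

definition graph_connected :: "'a set \<Rightarrow> 'a set set \<Rightarrow> bool" where
  "graph_connected V E \<longleftrightarrow> V \<noteq> {} \<and> (\<forall>u\<in>V. \<forall>v\<in>V. (u, v) \<in> {(a, b). {a, b} \<in> E}\<^sup>*)"

text \<open>
  A tensor of order k indexed by a finite set N is a function on index lists; only its values
  on lists of length k over N are relevant.
\<close>

type_synonym 'i tensor = "'i list \<Rightarrow> real"

definition tensor_apply :: "nat \<Rightarrow> 'i set \<Rightarrow> 'i tensor \<Rightarrow> ('i \<Rightarrow> real) \<Rightarrow> 'i \<Rightarrow> real" where
  "tensor_apply k N T x i =
     (\<Sum>js\<in>{js. set js \<subseteq> N \<and> length js = k - 1}. T (i # js) * prod_list (map x js))"

definition H_eigenvalue :: "nat \<Rightarrow> 'i set \<Rightarrow> 'i tensor \<Rightarrow> real \<Rightarrow> bool" where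
  "H_eigenvalue k N T l \<longleftrightarrow>
     (\<exists>x. (\<exists>i\<in>N. x i \<noteq> 0) \<and> (\<forall>i\<in>N. tensor_apply k N T x i = l * x i ^ (k - 1)))"

definition is_largest_H_eigenvalue :: "nat \<Rightarrow> 'i set \<Rightarrow> 'i tensor \<Rightarrow> real \<Rightarrow> bool" where
  "is_largest_H_eigenvalue k N T l \<longleftrightarrow>
     H_eigenvalue k N T l \<and> (\<forall>m. H_eigenvalue k N T m \<longrightarrow> m \<le> l)"

definition largest_H_eigenvalue :: "nat \<Rightarrow> 'i set \<Rightarrow> 'i tensor \<Rightarrow> real" where
  "largest_H_eigenvalue k N T = (THE l. is_largest_H_eigenvalue k N T l)"

definition hyper_degree :: "'b set set \<Rightarrow> 'b \<Rightarrow> nat" where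
  "hyper_degree F j = card {f \<in> F. j \<in> f}"

definition adjacency_tensor :: "nat \<Rightarrow> 'b set set \<Rightarrow> 'b tensor" where
  "adjacency_tensor k F js = (if set js \<in> F then 1 / fact (k - 1) else 0)"

definition degree_tensor :: "'b set set \<Rightarrow> 'b tensor" where
  "degree_tensor F js = (if \<forall>j\<in>set js. j = hd js then real (hyper_degree F (hd js)) else 0)"

definition signless_laplacian_tensor :: "nat \<Rightarrow> 'b set set \<Rightarrow> 'b tensor" where
  "signless_laplacian_tensor k F js = degree_tensor F js + adjacency_tensor k F js"

definition quotient_tensor :: "('i \<Rightarrow> 'b set) \<Rightarrow> 'b tensor \<Rightarrow> 'i tensor" where
  "quotient_tensor P T is =
     1 / real (card (P (hd is))) * (\<Sum>j\<in>P (hd is). \<Sum>js\<in>listset (map P (tl is)). T (j # js))"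

text \<open>
  The index set \<open>E \<union> V\<close> is a disjoint union, with \<open>Inl e\<close> for an edge and \<open>Inr v\<close> for a
  vertex of the graph. The new vertices of the hypergraph are tagged by the part they lie in,
  so that the parts \<open>V\<^sub>e\<close> and \<open>V\<^sub>v\<close> are pairwise disjoint.
\<close>

definition graph_index :: "'a set \<Rightarrow> 'a set set \<Rightarrow> ('a set + 'a) set" where
  "graph_index V E = E <+> V"

fun power_part :: "nat \<Rightarrow> nat \<Rightarrow> 'a set + 'a \<Rightarrow> (('a set + 'a) \<times> nat) set" where
  "power_part k s (Inl e) = {Inl e} \<times> {..<k - 2 * s}"
| "power_part k s (Inr v) = {Inr v} \<times> {..<s}"

definition power_vertices ::
    "'a set \<Rightarrow> 'a set set \<Rightarrow> nat \<Rightarrow> nat \<Rightarrow> (('a set + 'a) \<times> nat) set" where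
  "power_vertices V E k s = (\<Union>i\<in>graph_index V E. power_part k s i)"

definition power_edges :: "'a set set \<Rightarrow> nat \<Rightarrow> nat \<Rightarrow> (('a set + 'a) \<times> nat) set set" where
  "power_edges E k s =
     {power_part k s (Inr u) \<union> power_part k s (Inr v) \<union> power_part k s (Inl {u, v}) | u v.
       {u, v} \<in> E}"

definition power_Q :: "'a set set \<Rightarrow> nat \<Rightarrow> nat \<Rightarrow> (('a set + 'a) \<times> nat) tensor" where
  "power_Q E k s = signless_laplacian_tensor k (power_edges E k s)"

definition power_B :: "'a set set \<Rightarrow> nat \<Rightarrow> nat \<Rightarrow> ('a set + 'a) tensor" where
  "power_B E k s = quotient_tensor (power_part k s) (power_Q E k s)"

definition lambda_Q :: "'a set \<Rightarrow> 'a set set \<Rightarrow> nat \<Rightarrow> nat \<Rightarrow> real" where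
  "lambda_Q V E k s = largest_H_eigenvalue k (power_vertices V E k s) (power_Q E k s)"

definition lambda_B :: "'a set \<Rightarrow> 'a set set \<Rightarrow> nat \<Rightarrow> nat \<Rightarrow> real" where
  "lambda_B V E k s = largest_H_eigenvalue k (graph_index V E) (power_B E k s)"

end

theory Submission
  imports Defs "HOL-Analysis.Analysis" "HOL-Combinatorics.Multiset_Permutations"
begin

text \<open>
  A positive eigenvector of a nonnegative tensor belongs to its largest H-eigenvalue, and a
  positive eigenvector \<open>y\<close> of the quotient tensor, lifted to be constant on the parts, is one of
  the signless Laplacian tensor with the same eigenvalue \<open>\<lambda>\<close>. The equation at an edge \<open>e = uv\<close>
  reads \<open>(\<lambda> - 1) y\<^sub>e\<^bsup>2s\<^esup> = (y\<^sub>u y\<^sub>v)\<^sup>s\<close>; eliminating \<open>y\<^sub>e\<close> and putting \<open>w\<^sub>v = y\<^sub>v\<^bsup>k/2\<^esup>\<close> turns the vertex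
  equations into the linear system \<open>(D + c A) w = \<lambda> w\<close> for the degree and adjacency matrices of
  the graph, with \<open>c = (\<lambda> - 1)\<^bsup>1 - k/(2s)\<^esup>\<close>. This system has a solution with \<open>w > 0\<close> and \<open>\<lambda> > 2\<close>,
  since a connected graph on more than two vertices has a vertex of degree at least two.
  If \<open>k < k'\<close> but \<open>\<lambda> \<le> \<lambda>'\<close>, then \<open>c' < c\<close> because \<open>\<lambda> - 1 > 1\<close>, and pairing the two systems with
  each other's solution gives \<open>\<lambda>' < \<lambda>\<close>, a contradiction.
\<close>

section \<open>Largest H-eigenvalues and positive eigenvectors\<close>

lemma largest_H_eigenvalue_eq:
  assumes "is_largest_H_eigenvalue k N T l"
  shows "largest_H_eigenvalue k N T = l"
  unfolding largest_H_eigenvalue_def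
  by (rule the_equality) (use assms in \<open>auto simp: is_largest_H_eigenvalue_def intro: antisym\<close>)

text \<open>Given an eigenvector \<open>x\<close> for \<open>m\<close>, scale \<open>z\<close> by
  the least \<open>t\<close> with \<open>\<bar>x i\<bar> \<le> t * z i\<close> on \<open>N\<close>.
  Equality holds at some index \<open>j\<close>, and since \<open>T\<close> is nonnegative, the
  equations of \<open>x\<close> and \<open>t z\<close> at \<open>j\<close> compare as \<open>m *
  \<bar>x j\<bar> ^ (k - 1) \<le> l * \<bar>x j\<bar> ^ (k - 1)\<close>.\<close>

lemma positive_eigenvector_imp_largest_H_eigenvalue:
  assumes N: "finite N" "N \<noteq> {}"
    and T: "\<And>is. set is \<subseteq> N \<Longrightarrow> T is \<ge> 0"
    and z: "\<And>i. i \<in> N \<Longrightarrow> z i > 0"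
    and eig: "\<And>i. i \<in> N \<Longrightarrow> tensor_apply k N T z i = l * z i ^ (k - 1)"
  shows "is_largest_H_eigenvalue k N T l"
  unfolding is_largest_H_eigenvalue_def
proof (intro conjI allI impI)
  show "H_eigenvalue k N T l"
    unfolding H_eigenvalue_def using N z eig by (metis all_not_in_conv less_irrefl)
next
  fix m assume "H_eigenvalue k N T m"
  then obtain x i0 where i0: "i0 \<in> N" "x i0 \<noteq> 0"
    and x: "\<And>i. i \<in> N \<Longrightarrow> tensor_apply k N T x i = m * x i ^ (k - 1)"
    unfolding H_eigenvalue_def by blast
  define t where "t = Max ((\<lambda>i. \<bar>x i\<bar> / z i) ` N)"
  have "t \<in> (\<lambda>i. \<bar>x i\<bar> / z i) ` N" unfolding t_def using N by (intro Max_in) auto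
  then obtain j where j: "j \<in> N" "t = \<bar>x j\<bar> / z j" by auto
  have tge: "\<bar>x i\<bar> / z i \<le> t" if "i \<in> N" for i
    unfolding t_def using N that by (intro Max_ge) auto
  have xt: "\<bar>x i\<bar> \<le> t * z i" if "i \<in> N" for i
    using tge[OF that] z[OF that] by (simp add: field_simps)
  have "0 < \<bar>x i0\<bar> / z i0" using i0 z by simp
  with tge[OF i0(1)] have t: "t > 0" by linarith
  have xj: "\<bar>x j\<bar> = t * z j" using j z[OF j(1)] by simp
  have xjpos: "\<bar>x j\<bar> > 0" using xj t z[OF j(1)] by simp
  have pl: "\<bar>prod_list (map x js)\<bar> \<le> t ^ length js * prod_list (map z js)"
    if "set js \<subseteq> N" for js
    using that
  proof (induction js)
    case (Cons a js)
    have "\<bar>x a\<bar> * \<bar>prod_list (map x js)\<bar> \<le> (t * z a) * (t ^ length js * prod_list (map z js))"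
      using Cons xt t z[of a] by (intro mult_mono) auto
    then show ?case by (simp add: abs_mult mult_ac)
  qed simp
  have "m * \<bar>x j\<bar> ^ (k - 1) \<le> \<bar>m * x j ^ (k - 1)\<bar>"
    by (simp add: abs_mult power_abs mult_right_mono)
  also have "\<dots> = \<bar>tensor_apply k N T x j\<bar>" using x j by simp
  also have "\<dots> \<le> (\<Sum>js\<in>{js. set js \<subseteq> N \<and> length js = k - 1}.
      T (j # js) * (t ^ (k - 1) * prod_list (map z js)))"
    unfolding tensor_apply_def
  proof (rule order_trans[OF sum_abs], rule sum_mono)
    fix js assume js: "js \<in> {js. set js \<subseteq> N \<and> length js = k - 1}"
    then have "T (j # js) * \<bar>prod_list (map x js)\<bar> \<le> T (j # js) * (t ^ (k - 1) * prod_list (map z js))"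
      using T[of "j # js"] j(1) pl[of js] by (intro mult_left_mono) auto
    then show "\<bar>T (j # js) * prod_list (map x js)\<bar> \<le> T (j # js) * (t ^ (k - 1) * prod_list (map z js))"
      using T[of "j # js"] j(1) js by (simp add: abs_mult)
  qed
  also have "\<dots> = t ^ (k - 1) * tensor_apply k N T z j"
    by (simp add: tensor_apply_def sum_distrib_left mult_ac)
  also have "\<dots> = l * \<bar>x j\<bar> ^ (k - 1)"
    using eig j xj by (simp add: power_mult_distrib mult_ac)
  finally show "m \<le> l" using xjpos by simp
qed

section \<open>Quotient tensors and vectors constant on the parts\<close>

lemma mem_listset_iff: "js \<in> listset As \<longleftrightarrow> list_all2 (\<in>) js As"
  by (induction As arbitrary: js) (auto simp: set_Cons_def list_all2_Cons2)

text \<open>Group the lists over the union of the parts by the list of parts they run through, that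
  is, by \<open>map p\<close>. The lifted vector \<open>y \<circ> p\<close> has a constant product
  on each group, so summing over groups turns the quotient entries into an average of
  \<open>T\<close> applied to the lift.\<close>

lemma tensor_apply_quotient:
  assumes fin: "finite I" "\<And>i. i \<in> I \<Longrightarrow> finite (P i)"
    and part: "\<And>i j. i \<in> I \<Longrightarrow> j \<in> P i \<Longrightarrow> p j = i"
    and i: "i \<in> I"
  shows "tensor_apply k I (quotient_tensor P T) y i =
    (\<Sum>j\<in>P i. tensor_apply k (\<Union>i\<in>I. P i) T (y \<circ> p) j) / card (P i)"
proof -
  define S where "S = {js. set js \<subseteq> (\<Union>i\<in>I. P i) \<and> length js = k - 1}"
  define R where "R = {is. set is \<subseteq> I \<and> length is = k - 1}"
  have finS: "finite S" unfolding S_def using fin by (intro finite_lists_length_eq) auto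
  have finR: "finite R" unfolding R_def using fin by (intro finite_lists_length_eq) auto
  have img: "map p ` S \<subseteq> R" unfolding S_def R_def using part by fastforce
  \<comment> \<open>Since \<open>p\<close> recovers the part of an element, a product of parts is
    exactly a fibre of \<open>map p\<close>.\<close>
  have ls: "listset (map P is) = {js \<in> S. map p js = is}" if "is \<in> R" for "is"
  proof -
    have mem: "list_all2 (\<lambda>j i. j \<in> P i) js is \<longleftrightarrow>
        set js \<subseteq> (\<Union>i\<in>I. P i) \<and> length js = length is \<and> map p js = is"
      if "set is \<subseteq> I" for js "is"
      using that
    proof (induction "is" arbitrary: js)
      case (Cons i "is")
      have "j \<in> P i \<longleftrightarrow> j \<in> (\<Union>i\<in>I. P i) \<and> p j = i" for j
        using part Cons.prems by auto
      with Cons show ?case by (cases js) auto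
    qed auto
    have R: "set is \<subseteq> I" "length is = k - 1" using that by (auto simp: R_def)
    have "js \<in> listset (map P is) \<longleftrightarrow> js \<in> {js \<in> S. map p js = is}" for js
      unfolding mem_listset_iff list_all2_map2 mem[OF R(1)] by (simp add: S_def R(2))
    then show ?thesis by blast
  qed
  have "tensor_apply k I (quotient_tensor P T) y i =
    (\<Sum>is\<in>R. (\<Sum>j\<in>P i. \<Sum>js\<in>listset (map P is). T (j # js)) * prod_list (map y is)) / card (P i)"
    unfolding tensor_apply_def quotient_tensor_def R_def[symmetric] sum_divide_distrib[of _ R] by simp
  also have "(\<Sum>is\<in>R. (\<Sum>j\<in>P i. \<Sum>js\<in>listset (map P is). T (j # js)) * prod_list (map y is)) =
    (\<Sum>j\<in>P i. \<Sum>is\<in>R. \<Sum>js\<in>{js \<in> S. map p js = is}. T (j # js) * prod_list (map (y \<circ> p) js))"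
    by (subst sum.swap) (auto simp: sum_distrib_right ls intro!: sum.cong)
  also have "\<dots> = (\<Sum>j\<in>P i. \<Sum>js\<in>S. T (j # js) * prod_list (map (y \<circ> p) js))"
    by (simp add: sum.group[OF finS finR img])
  finally show ?thesis by (simp add: tensor_apply_def S_def)
qed

section \<open>The degree, adjacency and signless Laplacian tensors of a hypergraph\<close>

lemma tensor_apply_degree_tensor:
  fixes x :: "'b \<Rightarrow> real"
  assumes "finite N" "j \<in> N"
  shows "tensor_apply k N (degree_tensor F) x j = hyper_degree F j * x j ^ (k - 1)"
proof -
  have "tensor_apply k N (degree_tensor F) x j =
    (\<Sum>js\<in>{js. set js \<subseteq> N \<and> length js = k - 1}.
      if js = replicate (k - 1) j then hyper_degree F j * x j ^ (k - 1) else 0)"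
    unfolding tensor_apply_def degree_tensor_def
    by (intro sum.cong) (auto simp: replicate_eqI prod_list_replicate map_replicate)
  also have "\<dots> = hyper_degree F j * x j ^ (k - 1)"
    using assms by (subst sum.delta) (auto simp: finite_lists_length_eq)
  finally show ?thesis .
qed

text \<open>A list of length \<open>k - 1\<close> that completes \<open>j\<close> to an edge
  \<open>f\<close> must cover the \<open>k - 1\<close> elements of \<open>f - {j}\<close>, so it is
  a permutation of them. There are \<open>fact (k - 1)\<close> of these, which cancels the
  normalisation of the tensor.\<close>

lemma tensor_apply_adjacency_tensor:
  assumes N: "finite N" and j: "j \<in> N" and k: "k > 0"
    and F: "\<And>f. f \<in> F \<Longrightarrow> f \<subseteq> N \<and> card f = k"
  shows "tensor_apply k N (adjacency_tensor k F) x j = (\<Sum>f\<in>{f \<in> F. j \<in> f}. \<Prod>i\<in>f - {j}. x i)"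
proof -
  define S where "S = {js. set js \<subseteq> N \<and> length js = k - 1}"
  define G where "G = {f \<in> F. j \<in> f}"
  have finS: "finite S" unfolding S_def using N by (intro finite_lists_length_eq)
  have finG: "finite G" unfolding G_def
    by (rule finite_subset[of _ "Pow N"]) (use N F in auto)
  have perm: "{js \<in> S. insert j (set js) = f} = permutations_of_set (f - {j})" if f: "f \<in> G" for f
  proof -
    have fN: "f \<subseteq> N" "card f = k" "j \<in> f" using f F by (auto simp: G_def)
    have finf: "finite f" using fN N finite_subset by blast
    have card: "card (f - {j}) = k - 1" using fN finf by simp
    show ?thesis
    proof (intro equalityI subsetI)
      fix js assume "js \<in> {js \<in> S. insert j (set js) = f}"
      then have js: "length js = k - 1" "insert j (set js) = f" by (auto simp: S_def)
      have le: "card (set js) \<le> k - 1" using card_length[of js] js by simp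
      have sub: "f - {j} \<subseteq> set js" using js by auto
      have eq: "f - {j} = set js"
        by (rule card_seteq) (use sub le card in auto)
      then have "distinct js" using card js by (intro card_distinct) simp
      with eq show "js \<in> permutations_of_set (f - {j})" by (auto simp: permutations_of_set_def)
    next
      fix js assume "js \<in> permutations_of_set (f - {j})"
      then show "js \<in> {js \<in> S. insert j (set js) = f}"
        using fN card by (auto simp: permutations_of_set_def S_def distinct_card[symmetric])
    qed
  qed
  \<comment> \<open>The condition of being an edge becomes a sum over \<open>G\<close> with at most
    one nonzero term, so that the order of summation can be exchanged.\<close>
  have "tensor_apply k N (adjacency_tensor k F) x j =
    (\<Sum>js\<in>S. \<Sum>f\<in>G. if insert j (set js) = f then prod_list (map x js) / fact (k - 1) else 0)"
    unfolding tensor_apply_def adjacency_tensor_def S_def[symmetric]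
    using finG by (intro sum.cong) (auto simp: G_def)
  also have "\<dots> = (\<Sum>f\<in>G. \<Sum>js\<in>{js \<in> S. insert j (set js) = f}. prod_list (map x js) / fact (k - 1))"
    by (subst sum.swap) (simp add: sum.inter_filter[OF finS] del: One_nat_def)
  also have "\<dots> = (\<Sum>f\<in>G. \<Prod>i\<in>f - {j}. x i)"
  proof (intro sum.cong refl)
    fix f assume f: "f \<in> G"
    have fN: "f \<subseteq> N" "card f = k" "j \<in> f" using f F by (auto simp: G_def)
    have finf: "finite f" using fN N finite_subset by blast
    have card: "card (f - {j}) = k - 1" using fN finf by simp
    have "(\<Sum>js\<in>permutations_of_set (f - {j}). prod_list (map x js) / fact (k - 1)) =
      (\<Sum>js\<in>permutations_of_set (f - {j}). (\<Prod>i\<in>f - {j}. x i) / fact (k - 1))"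
      by (intro sum.cong refl)
        (auto simp: permutations_of_set_def prod.distinct_set_conv_list[symmetric])
    also have "\<dots> = (\<Prod>i\<in>f - {j}. x i)" using finf card by simp
    finally show "(\<Sum>js\<in>{js \<in> S. insert j (set js) = f}. prod_list (map x js) / fact (k - 1)) =
      (\<Prod>i\<in>f - {j}. x i)" by (simp add: perm[OF f])
  qed
  finally show ?thesis by (simp add: G_def)
qed

lemma tensor_apply_signless_laplacian:
  fixes x :: "'b \<Rightarrow> real"
  assumes "finite N" "j \<in> N" "k > 0" "\<And>f. f \<in> F \<Longrightarrow> f \<subseteq> N \<and> card f = k"
  shows "tensor_apply k N (signless_laplacian_tensor k F) x j =
    hyper_degree F j * x j ^ (k - 1) + (\<Sum>f\<in>{f \<in> F. j \<in> f}. \<Prod>i\<in>f - {j}. x i)"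
  using tensor_apply_degree_tensor[OF assms(1,2), of k F x]
    tensor_apply_adjacency_tensor[OF assms, where x = x]
  by (simp add: tensor_apply_def signless_laplacian_tensor_def distrib_right sum.distrib)

section \<open>A Perron eigenvector for a matrix that depends on its own eigenvalue\<close>

lemma compact_PiE_UNIV:
  fixes S :: "'i \<Rightarrow> real set"
  assumes "\<And>i. compact (S i)"
  shows "compact (PiE UNIV S)"
proof -
  \<comment> \<open>This is Tychonoff's theorem; the next line moves it to the topology that the
    function type carries.\<close>
  have "compactin (product_topology (\<lambda>i. euclidean) UNIV) (PiE UNIV S)"
    using assms by (simp add: compactin_PiE)
  then show ?thesis by (simp add: euclidean_product_topology)
qed

text \<open>This is the first-order condition at a maximum: if \<open>p\<close> were nonzero, a
  \<open>t\<close> of the same sign and small compared with \<open>1 / \<bar>q\<bar>\<close> would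
  let the linear term win.\<close>

lemma nonpos_quadratic_imp_linear_coeff_0:
  fixes p q :: real
  assumes "\<And>t. 2 * t * p + t\<^sup>2 * q \<le> 0"
  shows "p = 0"
proof (rule ccontr)
  assume p: "p \<noteq> 0"
  define t where "t = p / (\<bar>q\<bar> + 1)"
  have "t\<^sup>2 * (- q) \<le> t\<^sup>2 * \<bar>q\<bar>" by (intro mult_left_mono) auto
  moreover have "t * p = t\<^sup>2 * (\<bar>q\<bar> + 1)" by (simp add: t_def power2_eq_square)
  ultimately have "t\<^sup>2 * (\<bar>q\<bar> + 2) \<le> 0" using assms[of t] by (simp add: algebra_simps)
  moreover have "t\<^sup>2 > 0" using p by (simp add: t_def)
  then have "t\<^sup>2 * (\<bar>q\<bar> + 2) > 0" by (intro mult_pos_pos) auto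
  ultimately show False by simp
qed

text \<open>
  The eigenvalue is the largest \<open>l\<close> for which the quadratic form of \<open>D + c(l) A - l\<close> is still
  nonnegative at some unit vector: there the form is negative semidefinite and vanishes at that
  vector, hence also at its absolute value, which therefore lies in the kernel.
\<close>

lemma self_consistent_Perron_eigenvector:
  fixes a :: "'a \<Rightarrow> 'a \<Rightarrow> real" and d :: "'a \<Rightarrow> real" and c :: "real \<Rightarrow> real"
  assumes V: "finite V"
    and a0: "\<And>u v. a u v \<ge> 0" and asym: "\<And>u v. a u v = a v u"
    and irred: "\<And>u v. u \<in> V \<Longrightarrow> v \<in> V \<Longrightarrow> (u, v) \<in> {(x, y). x \<in> V \<and> y \<in> V \<and> a x y > 0}\<^sup>*"
    and cont: "continuous_on {l0..} c"
    and c: "\<And>l. l \<ge> l0 \<Longrightarrow> 0 < c l \<and> c l \<le> C"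
    and v0: "v0 \<in> V" "l0 \<le> d v0"
  obtains l w where "l \<ge> l0" "\<And>v. v \<in> V \<Longrightarrow> w v > 0"
    "\<And>v. v \<in> V \<Longrightarrow> d v * w v + c l * (\<Sum>u\<in>V. a v u * w u) = l * w v"
proof -
  \<comment> \<open>The quadratic form of \<open>D + c(l) A - l\<close> at \<open>w\<close>.\<close>
  define q where "q l w = (\<Sum>v\<in>V. d v * (w v)\<^sup>2) + c l * (\<Sum>v\<in>V. \<Sum>u\<in>V. a v u * (w v * w u))
    - l * (\<Sum>v\<in>V. (w v)\<^sup>2)" for l w
  define M where "M = (\<Sum>v\<in>V. \<bar>d v\<bar>) + C * (\<Sum>v\<in>V. \<Sum>u\<in>V. a v u)"
  \<comment> \<open>Every admissible \<open>l\<close> is at most \<open>M\<close>. The upper end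
    lies strictly above that, so the maximal \<open>l\<close> found below still leaves room for
    slightly larger values.\<close>
  define L where "L = max l0 M + 1"
  have unit_le: "\<bar>w v\<bar> \<le> 1" if "(\<Sum>v\<in>V. (w v)\<^sup>2) = 1" "v \<in> V" for v and w :: "'a \<Rightarrow> real"
  proof -
    have "(w v)\<^sup>2 \<le> (\<Sum>v\<in>V. (w v)\<^sup>2)" using V that by (intro member_le_sum) auto
    with that show ?thesis by (simp add: abs_square_le_1)
  qed
  have l_le: "l \<le> M" if "l \<ge> l0" "(\<Sum>v\<in>V. (w v)\<^sup>2) = 1" "q l w \<ge> 0" for l w
  proof -
    have "(\<Sum>v\<in>V. d v * (w v)\<^sup>2) \<le> (\<Sum>v\<in>V. \<bar>d v\<bar>)"
    proof (intro sum_mono)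
      fix v assume "v \<in> V"
      then have "\<bar>d v\<bar> * (w v)\<^sup>2 \<le> \<bar>d v\<bar> * 1"
        using unit_le[OF that(2), of v] by (intro mult_left_mono) (auto simp: abs_square_le_1)
      moreover have "d v * (w v)\<^sup>2 \<le> \<bar>d v\<bar> * (w v)\<^sup>2" by (intro mult_right_mono) auto
      ultimately show "d v * (w v)\<^sup>2 \<le> \<bar>d v\<bar>" by simp
    qed
    moreover have "c l * (\<Sum>v\<in>V. \<Sum>u\<in>V. a v u * (w v * w u)) \<le> c l * (\<Sum>v\<in>V. \<Sum>u\<in>V. a v u)"
    proof (intro mult_left_mono sum_mono)
      fix v u assume "v \<in> V" "u \<in> V"
      then have "\<bar>w v\<bar> * \<bar>w u\<bar> \<le> 1 * 1" using unit_le[OF that(2)] by (intro mult_mono) auto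
      then have "w v * w u \<le> 1" by (simp add: abs_mult[symmetric])
      then show "a v u * (w v * w u) \<le> a v u" using a0[of v u] mult_left_mono by fastforce
    qed (use c that in \<open>simp add: less_imp_le\<close>)
    moreover have "\<dots> \<le> C * (\<Sum>v\<in>V. \<Sum>u\<in>V. a v u)"
      using c that a0 by (intro mult_right_mono sum_nonneg) auto
    ultimately show ?thesis using that by (simp add: q_def M_def)
  qed
  \<comment> \<open>Vectors are functions on the whole type; forcing them to vanish off
    \<open>V\<close> gives a compact set and changes neither \<open>q\<close> nor the norm, which
    only see values on \<open>V\<close>.\<close>
  define K where "K = {l0..L} \<times> PiE UNIV (\<lambda>v. if v \<in> V then {-1..1} else {0::real})"
  have K: "compact K" unfolding K_def by (intro compact_Times compact_PiE_UNIV) auto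
  have contq: "continuous_on K (\<lambda>p. q (fst p) (snd p))"
  proof -
    have [continuous_intros]: "continuous_on K (\<lambda>p. snd p v)" for v
      by (rule continuous_on_product_then_coordinatewise) (intro continuous_intros)
    have [continuous_intros]: "continuous_on K (\<lambda>p. c (fst p))"
      by (rule continuous_on_compose2[OF cont]) (auto simp: K_def intro!: continuous_intros)
    show ?thesis unfolding q_def by (intro continuous_intros)
  qed
  have contn: "continuous_on K (\<lambda>p. \<Sum>v\<in>V. (snd p v)\<^sup>2)"
  proof -
    have [continuous_intros]: "continuous_on K (\<lambda>p. snd p v)" for v
      by (rule continuous_on_product_then_coordinatewise) (intro continuous_intros)
    show ?thesis by (intro continuous_intros)
  qed
  define K' where "K' = {p \<in> K. (\<Sum>v\<in>V. (snd p v)\<^sup>2) = 1 \<and> q (fst p) (snd p) \<ge> 0}"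
  have "K' = (K \<inter> (\<lambda>p. \<Sum>v\<in>V. (snd p v)\<^sup>2) -` {1}) \<inter> (K \<inter> (\<lambda>p. q (fst p) (snd p)) -` {0..})"
    by (auto simp: K'_def)
  also have "compact \<dots>"
  proof -
    have "closedin (top_of_set K) (K \<inter> (\<lambda>p. \<Sum>v\<in>V. (snd p v)\<^sup>2) -` {1})"
      "closedin (top_of_set K) (K \<inter> (\<lambda>p. q (fst p) (snd p)) -` {0..})"
      by (auto intro!: continuous_closedin_preimage contn contq)
    then show ?thesis by (rule closedin_compact[OF K closedin_Int])
  qed
  finally have K': "compact K'" .
  have K'I: "(m, \<lambda>v. if v \<in> V then w v else 0) \<in> K'"
    if "l0 \<le> m" "m \<le> L" "(\<Sum>v\<in>V. (w v)\<^sup>2) = 1" "q m w \<ge> 0" for m w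
  proof -
    have "q m (\<lambda>v. if v \<in> V then w v else 0) = q m w" by (simp add: q_def cong: sum.cong)
    moreover have "(\<Sum>v\<in>V. (if v \<in> V then w v else 0)\<^sup>2) = 1"
      using that by (simp cong: sum.cong)
    moreover have "w v \<le> 1" "- 1 \<le> w v" if "v \<in> V" for v
      using unit_le[OF \<open>(\<Sum>v\<in>V. (w v)\<^sup>2) = 1\<close> that] by auto
    ultimately show ?thesis using that by (auto simp: K'_def K_def)
  qed
  \<comment> \<open>Coordinate vectors serve twice: the one at \<open>v0\<close> shows that
    \<open>K'\<close> is nonempty, because \<open>l0 \<le> d v0\<close>, and all of them are
    directions of variation later.\<close>
  define e where "e v = (\<lambda>u. if u = v then 1 else 0 :: real)" for v :: 'a
  have "q l0 (e v0) = d v0 + c l0 * a v0 v0 - l0"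
    using V v0 by (simp add: q_def e_def if_distrib[of "\<lambda>x. _ * x"] if_distrib[of "\<lambda>x. x * _"]
        if_distrib[of "\<lambda>x. x ^ 2"] sum.delta cong: if_cong)
  moreover have "c l0 * a v0 v0 \<ge> 0" using c[of l0] a0 by simp
  ultimately have "q l0 (e v0) \<ge> 0" using v0 by simp
  moreover have "(\<Sum>v\<in>V. (e v0 v)\<^sup>2) = 1"
    using V v0 by (simp add: e_def if_distrib[of "\<lambda>x. x ^ 2"] sum.delta cong: if_cong)
  moreover have "l0 \<le> L" unfolding L_def by linarith
  ultimately have "K' \<noteq> {}" using K'I[of l0 "e v0"] by auto
  then obtain p where p: "p \<in> K'" "\<And>p'. p' \<in> K' \<Longrightarrow> fst p' \<le> fst p"
    using continuous_attains_sup[OF K' _ continuous_on_fst[OF continuous_on_id]] by blast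
  obtain l w where lw: "p = (l, w)" by (cases p)
  have l: "l0 \<le> l" and w1: "(\<Sum>v\<in>V. (w v)\<^sup>2) = 1" and qw: "q l w \<ge> 0"
    using p(1) by (auto simp: lw K'_def K_def)
  have lL: "l < L" using l_le[OF l w1 qw] by (simp add: L_def)
  \<comment> \<open>A positive value at a unit vector would survive a small increase of
    \<open>l\<close> by continuity, against the maximality of \<open>l\<close>.\<close>
  have q_unit: "q l x \<le> 0" if x: "(\<Sum>v\<in>V. (x v)\<^sup>2) = 1" for x
  proof (rule ccontr)
    assume "\<not> q l x \<le> 0"
    then have pos: "q l x > 0" by simp
    have "continuous_on {l0..L} c" by (rule continuous_on_subset[OF cont]) auto
    then have "continuous_on {l0..L} (\<lambda>m. q m x)" unfolding q_def by (intro continuous_intros)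
    then obtain \<delta> where \<delta>: "\<delta> > 0" "\<And>m. m \<in> {l0..L} \<Longrightarrow> \<bar>m - l\<bar> < \<delta> \<Longrightarrow> \<bar>q m x - q l x\<bar> < q l x"
      using pos l lL unfolding continuous_on_iff dist_real_def
      by (metis atLeastAtMost_iff less_imp_le)
    define m where "m = min (l + \<delta> / 2) L"
    have m: "l < m" "m \<le> L" "\<bar>m - l\<bar> < \<delta>" using \<delta>(1) lL by (auto simp: m_def)
    then have "q m x \<ge> 0" using \<delta>(2)[of m] l by auto
    then have "(m, \<lambda>v. if v \<in> V then x v else 0) \<in> K'" using m l x by (intro K'I) auto
    then show False using p(2) m lw by fastforce
  qed
  have q_scale: "q l (\<lambda>v. r * x v) = r\<^sup>2 * q l x" for r x
    by (simp add: q_def power_mult_distrib sum_distrib_left algebra_simps power2_eq_square)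
  have q_le: "q l x \<le> 0" for x
  proof (cases "(\<Sum>v\<in>V. (x v)\<^sup>2) = 0")
    case True
    then have "\<And>v. v \<in> V \<Longrightarrow> x v = 0" using V by (simp add: sum_nonneg_eq_0_iff)
    then show ?thesis by (simp add: q_def)
  next
    case False
    define r where "r = 1 / sqrt (\<Sum>v\<in>V. (x v)\<^sup>2)"
    have S: "(\<Sum>v\<in>V. (x v)\<^sup>2) > 0" using False by (simp add: sum_nonneg less_le)
    then have r: "r\<^sup>2 * (\<Sum>v\<in>V. (x v)\<^sup>2) = 1" by (simp add: r_def power_divide)
    then have "(\<Sum>v\<in>V. (r * x v)\<^sup>2) = 1" by (simp add: power_mult_distrib sum_distrib_left)
    from q_unit[OF this] have "r\<^sup>2 * q l x \<le> 0" by (simp add: q_scale)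
    moreover have "r\<^sup>2 > 0" using S by (simp add: r_def)
    ultimately show ?thesis by (simp add: mult_le_0_iff)
  qed
  define z where "z v = \<bar>w v\<bar>" for v
  \<comment> \<open>Passing to absolute values leaves the diagonal terms alone and can only raise
    the mixed ones.\<close>
  have "(\<Sum>v\<in>V. \<Sum>u\<in>V. a v u * (w v * w u)) \<le> (\<Sum>v\<in>V. \<Sum>u\<in>V. a v u * (z v * z u))"
    unfolding z_def abs_mult[symmetric] by (intro sum_mono mult_left_mono a0) simp
  then have "c l * (\<Sum>v\<in>V. \<Sum>u\<in>V. a v u * (w v * w u)) \<le> c l * (\<Sum>v\<in>V. \<Sum>u\<in>V. a v u * (z v * z u))"
    using c[OF l] by (intro mult_left_mono) auto
  then have qz: "q l z \<ge> 0" using qw by (simp add: q_def z_def)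
  \<comment> \<open>\<open>G x\<close> is the matrix of the form applied to \<open>x\<close>, hence
    half the gradient of \<open>q l\<close> at \<open>x\<close>.\<close>
  define G where "G x v = d v * x v + c l * (\<Sum>u\<in>V. a v u * x u) - l * x v" for x v
  have q_eq: "q l x = (\<Sum>v\<in>V. x v * G x v)" for x
    by (simp add: q_def G_def algebra_simps sum.distrib sum_subtractf sum_distrib_left power2_eq_square)
  have G_add: "G (\<lambda>u. x u + t * y u) v = G x v + t * G y v" for x y t v
    by (simp add: G_def algebra_simps sum.distrib sum_distrib_left)
  have G_sym: "(\<Sum>v\<in>V. x v * G y v) = (\<Sum>v\<in>V. y v * G x v)" for x y
  proof -
    have "(\<Sum>v\<in>V. \<Sum>u\<in>V. x v * (a v u * y u)) = (\<Sum>v\<in>V. \<Sum>u\<in>V. y v * (a v u * x u))"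
      by (subst sum.swap) (simp add: asym mult_ac)
    then have "(\<Sum>v\<in>V. x v * (\<Sum>u\<in>V. a v u * y u)) = (\<Sum>v\<in>V. y v * (\<Sum>u\<in>V. a v u * x u))"
      by (simp add: sum_distrib_left)
    then have "c l * (\<Sum>v\<in>V. x v * (\<Sum>u\<in>V. a v u * y u)) = c l * (\<Sum>v\<in>V. y v * (\<Sum>u\<in>V. a v u * x u))"
      by simp
    moreover have "(\<Sum>v\<in>V. x v * G y v) = (\<Sum>v\<in>V. (d v - l) * (x v * y v))
        + c l * (\<Sum>v\<in>V. x v * (\<Sum>u\<in>V. a v u * y u))" for x y
      unfolding G_def sum_distrib_left[of "c l"] sum.distrib[symmetric]
      by (intro sum.cong refl) (simp add: algebra_simps sum_distrib_left)
    ultimately show ?thesis by (simp add: mult.commute)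
  qed
  \<comment> \<open>The form is nowhere positive but nonnegative at \<open>z\<close>, so
    \<open>z\<close> maximises it and the derivative in each coordinate direction vanishes.\<close>
  have G0: "G z v = 0" if v: "v \<in> V" for v
  proof (rule nonpos_quadratic_imp_linear_coeff_0)
    fix t :: real
    have "q l (\<lambda>u. z u + t * e v u) = q l z + 2 * t * (\<Sum>u\<in>V. e v u * G z u) + t\<^sup>2 * q l (e v)"
      using G_sym[of z "e v"]
      by (simp add: q_eq G_add algebra_simps sum.distrib sum_distrib_left[symmetric] power2_eq_square)
    moreover have "(\<Sum>u\<in>V. e v u * G z u) = G z v"
      using V v by (simp add: e_def if_distrib[of "\<lambda>x. x * _"] sum.delta cong: if_cong)
    ultimately show "2 * t * G z v + t\<^sup>2 * q l (e v) \<le> 0"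
      using q_le[of "\<lambda>u. z u + t * e v u"] qz by simp
  qed
  have zpos: "z v > 0" if v: "v \<in> V" for v
  proof -
    have "\<exists>u\<in>V. w u \<noteq> 0"
    proof (rule ccontr)
      assume "\<not> (\<exists>u\<in>V. w u \<noteq> 0)"
      then have "(\<Sum>v\<in>V. (w v)\<^sup>2) = 0" by (intro sum.neutral) auto
      with w1 show False by simp
    qed
    then obtain u where u: "u \<in> V" "z u > 0" by (auto simp: z_def)
    \<comment> \<open>Positivity spreads along the edges: if \<open>z y\<close> were zero, the
      equation at \<open>y\<close> would make a positive sum over neighbours vanish.\<close>
    from irred[OF u(1) v] show ?thesis
    proof (induction rule: rtrancl_induct)
      case (step x y)
      then have xy: "x \<in> V" "y \<in> V" "a x y > 0" by auto
      have "a y x * z x \<le> (\<Sum>u\<in>V. a y u * z u)"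
        using V xy a0 by (intro member_le_sum) (auto simp: z_def)
      moreover have "a y x * z x > 0" using xy step asym[of x y] by simp
      ultimately have "c l * (\<Sum>u\<in>V. a y u * z u) > 0" using c[OF l] by simp
      then have "z y \<noteq> 0" using G0[OF xy(2)] by (auto simp: G_def)
      then show ?case by (simp add: z_def)
    qed (use u in simp)
  qed
  show ?thesis
  proof (rule that[of l z])
    show "d v * z v + c l * (\<Sum>u\<in>V. a v u * z u) = l * z v" if "v \<in> V" for v
      using G0[OF that] by (simp add: G_def)
  qed (use l zpos in auto)
qed

section \<open>Generalized power hypergraphs and their eigenvector equations\<close>

definition power_edge :: "nat \<Rightarrow> nat \<Rightarrow> 'a set \<Rightarrow> (('a set + 'a) \<times> nat) set" where
  "power_edge k s e = (Inr ` e) \<times> {..<s} \<union> {Inl e} \<times> {..<k - 2 * s}"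

lemma finite_simple_graph:
  assumes "simple_graph V E"
  shows "finite V" "finite E" "e \<in> E \<Longrightarrow> finite e"
  using assms finite_subset[of E "Pow V"] finite_subset[of e V] by (auto simp: simple_graph_def)

lemma simple_graph_edgeE:
  assumes "simple_graph V E" "e \<in> E"
  obtains u v where "e = {u, v}" "u \<noteq> v" "u \<in> V" "v \<in> V"
proof -
  have "e \<subseteq> V" "card e = 2" using assms by (auto simp: simple_graph_def)
  then show thesis using that by (auto simp: card_2_iff)
qed

text \<open>Indexing hyperedges by graph edges instead of ordered endpoints allows sums over
  hyperedges to be reindexed over \<open>E\<close>.\<close>

lemma power_edges_eq_image:
  assumes "simple_graph V E"
  shows "power_edges E k s = power_edge k s ` E"
proof -
  have "power_part k s (Inr u) \<union> power_part k s (Inr v) \<union> power_part k s (Inl {u, v}) =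
      power_edge k s {u, v}" for u v :: 'a
    by (auto simp: power_edge_def)
  then have "power_edges E k s = {power_edge k s {u, v} | u v. {u, v} \<in> E}"
    by (simp add: power_edges_def)
  also have "\<dots> = power_edge k s ` E"
    using simple_graph_edgeE[OF assms] by blast
  finally show ?thesis .
qed

text \<open>As \<open>2 * s < k\<close>, the part of the edge itself is nonempty, and its tag
  reveals the edge.\<close>

lemma inj_on_power_edge:
  assumes "2 * s < k"
  shows "inj_on (power_edge k s) E"
proof (rule inj_onI)
  fix e e' assume eq: "power_edge k s e = power_edge k s e'"
  have "(Inl e, 0) \<in> power_edge k s e" using assms by (simp add: power_edge_def)
  then show "e = e'" unfolding eq by (auto simp: power_edge_def)
qed

lemma card_power_edge:
  assumes "card e = 2" "2 * s < k"
  shows "card (power_edge k s e) = k"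
proof -
  have "finite e" using assms(1) card_ge_0_finite by force
  then have "card (power_edge k s e) = card ((Inr ` e :: ('a set + 'a) set) \<times> {..<s}) +
      card ({Inl e :: 'a set + 'a} \<times> {..<k - 2 * s})"
    unfolding power_edge_def by (intro card_Un_disjoint) auto
  also have "\<dots> = k" using assms by (simp add: card_cartesian_product card_image)
  finally show ?thesis .
qed

lemma prod_power_edge:
  fixes y :: "'a set + 'a \<Rightarrow> real"
  assumes "finite e"
  shows "(\<Prod>j\<in>power_edge k s e. y (fst j)) = (\<Prod>v\<in>e. y (Inr v)) ^ s * y (Inl e) ^ (k - 2 * s)"
proof -
  have "(\<Prod>j\<in>power_edge k s e. y (fst j)) =
    (\<Prod>j\<in>(Inr ` e) \<times> {..<s}. y (fst j)) * (\<Prod>j\<in>{Inl e} \<times> {..<k - 2 * s}. y (fst j))"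
    unfolding power_edge_def using assms by (intro prod.union_disjoint) auto
  also have "(\<Prod>j\<in>(Inr ` e) \<times> {..<s}. y (fst j)) = (\<Prod>i\<in>Inr ` e. \<Prod>n<s. y i)"
    unfolding prod.cartesian_product by (intro prod.cong) auto
  also have "\<dots> = (\<Prod>v\<in>e. y (Inr v)) ^ s"
    by (subst prod.reindex) (auto simp: prod_power_distrib)
  also have "(\<Prod>j\<in>{Inl e} \<times> {..<k - 2 * s}. y (fst j)) = (\<Prod>i\<in>{Inl e}. \<Prod>n<k - 2 * s. y i)"
    unfolding prod.cartesian_product by (intro prod.cong) auto
  finally show ?thesis by simp
qed

text \<open>Treats both kinds of index uniformly: the hyperedge of \<open>e\<close> contains the
  part of \<open>i\<close> exactly when \<open>incident i e\<close>, so an edge index meets only its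
  own hyperedge.\<close>

fun incident :: "'a set + 'a \<Rightarrow> 'a set \<Rightarrow> bool" where
  "incident (Inl e') e \<longleftrightarrow> e = e'"
| "incident (Inr v) e \<longleftrightarrow> v \<in> e"

lemma mem_power_edge_iff_incident:
  "n < (case i of Inl _ \<Rightarrow> k - 2 * s | Inr _ \<Rightarrow> s) \<Longrightarrow> (i, n) \<in> power_edge k s e \<longleftrightarrow> incident i e"
  by (cases i) (auto simp: power_edge_def)

lemma mem_power_vertices_iff:
  "(i, n) \<in> power_vertices V E k s \<longleftrightarrow>
    i \<in> graph_index V E \<and> n < (case i of Inl _ \<Rightarrow> k - 2 * s | Inr _ \<Rightarrow> s)"
proof -
  have "(i, n) \<in> power_part k s i' \<longleftrightarrow> i' = i \<and> n < (case i of Inl _ \<Rightarrow> k - 2 * s | Inr _ \<Rightarrow> s)" for i'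
    by (cases i') auto
  then show ?thesis by (auto simp: power_vertices_def)
qed

lemma finite_power_part: "finite (power_part k s i)"
  by (cases i) auto

lemma finite_graph_index: "simple_graph V E \<Longrightarrow> finite (graph_index V E)"
  by (simp add: graph_index_def finite_simple_graph)

lemma finite_power_vertices: "simple_graph V E \<Longrightarrow> finite (power_vertices V E k s)"
  by (simp add: power_vertices_def finite_graph_index finite_power_part)

text \<open>The factor \<open>y i\<close> restores the element missing from each product over
  \<open>power_edge k s e - {(i, n)}\<close>. The completed product depends on \<open>e\<close>
  alone, which gives edge and vertex indices one common equation.\<close>

lemma tensor_apply_power_Q:
  fixes y :: "'a set + 'a \<Rightarrow> real"
  assumes G: "simple_graph V E" and k: "2 * s < k" and j: "(i, n) \<in> power_vertices V E k s"
  shows "y i * tensor_apply k (power_vertices V E k s) (power_Q E k s) (y \<circ> fst) (i, n) =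
    card {e \<in> E. incident i e} * y i ^ k +
    (\<Sum>e | e \<in> E \<and> incident i e. (\<Prod>v\<in>e. y (Inr v)) ^ s * y (Inl e) ^ (k - 2 * s))"
proof -
  have inc: "(i, n) \<in> power_edge k s e \<longleftrightarrow> incident i e" for e
    using j by (intro mem_power_edge_iff_incident) (simp add: mem_power_vertices_iff)
  have fs: "{f \<in> power_edges E k s. (i, n) \<in> f} = power_edge k s ` {e \<in> E. incident i e}"
    by (auto simp: power_edges_eq_image[OF G] inc)
  have inj: "inj_on (power_edge k s) {e \<in> E. incident i e}" using k by (rule inj_on_power_edge)
  have deg: "hyper_degree (power_edges E k s) (i, n) = card {e \<in> E. incident i e}"
    unfolding hyper_degree_def fs by (rule card_image[OF inj])
  have "f \<subseteq> power_vertices V E k s \<and> card f = k" if f: "f \<in> power_edges E k s" for f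
  proof -
    obtain e where e: "e \<in> E" "f = power_edge k s e"
      using f by (auto simp: power_edges_eq_image[OF G])
    have "e \<subseteq> V" "card e = 2" using G e by (auto simp: simple_graph_def)
    moreover from this e have "f \<subseteq> power_vertices V E k s"
      by (auto simp: power_edge_def mem_power_vertices_iff graph_index_def)
    ultimately show ?thesis using k e by (simp add: card_power_edge)
  qed
  then have "tensor_apply k (power_vertices V E k s) (power_Q E k s) (y \<circ> fst) (i, n) =
    card {e \<in> E. incident i e} * y i ^ (k - 1) +
    (\<Sum>e | e \<in> E \<and> incident i e. \<Prod>j\<in>power_edge k s e - {(i, n)}. y (fst j))"
    using k j unfolding power_Q_def
    by (subst tensor_apply_signless_laplacian)
      (auto simp: finite_power_vertices[OF G] deg fs sum.reindex[OF inj])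
  moreover have "y i * (\<Prod>j\<in>power_edge k s e - {(i, n)}. y (fst j)) =
      (\<Prod>v\<in>e. y (Inr v)) ^ s * y (Inl e) ^ (k - 2 * s)" if e: "e \<in> E" "incident i e" for e
  proof -
    have "finite e" using finite_simple_graph(3)[OF G e(1)] .
    moreover from this have "finite (power_edge k s e)" by (simp add: power_edge_def)
    ultimately show ?thesis
      using prod.remove[of "power_edge k s e" "(i, n)" "\<lambda>j. y (fst j)"] e inc
      by (simp add: prod_power_edge)
  qed
  moreover have "y i * y i ^ (k - 1) = y i ^ k" using k by (cases k) auto
  ultimately show ?thesis
    by (simp add: distrib_left sum_distrib_left mult.left_commute[of "y i"])
qed

lemma power_Q_nonneg: "power_Q E k s js \<ge> 0"
  by (simp add: power_Q_def signless_laplacian_tensor_def degree_tensor_def adjacency_tensor_def)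

lemma power_B_nonneg: "power_B E k s is \<ge> 0"
  by (simp add: power_B_def quotient_tensor_def power_Q_nonneg sum_nonneg)

text \<open>Cancelling \<open>y i > 0\<close> makes the lift of \<open>y\<close> an eigenvector of
  the signless Laplacian tensor; averaging over the parts makes \<open>y\<close> one of the quotient
  tensor. Both are positive, so \<open>l\<close> is the largest eigenvalue on either side.\<close>

lemma is_largest_H_eigenvalue_power_B_power_Q:
  fixes y :: "'a set + 'a \<Rightarrow> real"
  assumes G: "simple_graph V E" "V \<noteq> {}" and k: "2 * s < k" and s: "1 \<le> s"
    and y: "\<And>i. i \<in> graph_index V E \<Longrightarrow> y i > 0"
    and eq: "\<And>i. i \<in> graph_index V E \<Longrightarrow> card {e \<in> E. incident i e} * y i ^ k +
      (\<Sum>e | e \<in> E \<and> incident i e. (\<Prod>v\<in>e. y (Inr v)) ^ s * y (Inl e) ^ (k - 2 * s)) = l * y i ^ k"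
  shows "is_largest_H_eigenvalue k (graph_index V E) (power_B E k s) l"
    and "is_largest_H_eigenvalue k (power_vertices V E k s) (power_Q E k s) l"
proof -
  have Q: "tensor_apply k (power_vertices V E k s) (power_Q E k s) (y \<circ> fst) j = l * (y \<circ> fst) j ^ (k - 1)"
    if j: "j \<in> power_vertices V E k s" for j
  proof -
    obtain i n where jn: "j = (i, n)" by (cases j)
    have i: "i \<in> graph_index V E" using j by (simp add: jn mem_power_vertices_iff)
    have "y i * tensor_apply k (power_vertices V E k s) (power_Q E k s) (y \<circ> fst) (i, n) = l * y i ^ k"
      using tensor_apply_power_Q[OF G(1) k, of i n y] j eq[OF i] by (simp add: jn)
    also have "\<dots> = y i * (l * y i ^ (k - 1))" using k by (cases k) auto
    finally show ?thesis using y[OF i] by (simp add: jn)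
  qed
  obtain v where v: "v \<in> V" using G by blast
  then have ne: "Inr v \<in> graph_index V E" "(Inr v, 0) \<in> power_vertices V E k s"
    using s by (auto simp: graph_index_def mem_power_vertices_iff)
  show "is_largest_H_eigenvalue k (power_vertices V E k s) (power_Q E k s) l"
  proof (rule positive_eigenvector_imp_largest_H_eigenvalue[OF _ _ _ _ Q])
    show "(y \<circ> fst) j > 0" if "j \<in> power_vertices V E k s" for j
      using that y by (cases j) (auto simp: mem_power_vertices_iff)
  qed (use ne in \<open>auto simp: finite_power_vertices[OF G(1)] power_Q_nonneg\<close>)
  have "tensor_apply k (graph_index V E) (power_B E k s) y i = l * y i ^ (k - 1)"
    if i: "i \<in> graph_index V E" for i
  proof -
    have pp: "j \<in> power_part k s i \<Longrightarrow> fst j = i" for i :: "'a set + 'a" and j by (cases i) auto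
    have card: "card (power_part k s i) > 0" using k s by (cases i) (auto simp: card_cartesian_product)
    have "tensor_apply k (graph_index V E) (power_B E k s) y i =
      (\<Sum>j\<in>power_part k s i. tensor_apply k (power_vertices V E k s) (power_Q E k s) (y \<circ> fst) j) /
        card (power_part k s i)"
      unfolding power_B_def power_vertices_def
      by (rule tensor_apply_quotient) (use i pp in \<open>auto simp: finite_graph_index[OF G(1)] finite_power_part\<close>)
    also have "(\<Sum>j\<in>power_part k s i. tensor_apply k (power_vertices V E k s) (power_Q E k s) (y \<circ> fst) j) =
      (\<Sum>j\<in>power_part k s i. l * y i ^ (k - 1))"
    proof (intro sum.cong refl)
      fix j assume j: "j \<in> power_part k s i"
      then have "j \<in> power_vertices V E k s" using i by (auto simp: power_vertices_def)
      from Q[OF this] pp[OF j]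
      show "tensor_apply k (power_vertices V E k s) (power_Q E k s) (y \<circ> fst) j = l * y i ^ (k - 1)"
        by simp
    qed
    finally show ?thesis using card by simp
  qed
  then show "is_largest_H_eigenvalue k (graph_index V E) (power_B E k s) l"
    using ne y by (intro positive_eigenvector_imp_largest_H_eigenvalue[where z = y])
      (auto simp: finite_graph_index[OF G(1)] power_B_nonneg)
qed

section \<open>Reduction to a linear system on the graph\<close>

lemma sum_incident_edges_eq_sum_adjacent:
  fixes g :: "'a set \<Rightarrow> real"
  assumes G: "simple_graph V E" and v: "v \<in> V"
  shows "(\<Sum>e | e \<in> E \<and> v \<in> e. g e) = (\<Sum>u\<in>V. if {v, u} \<in> E then g {v, u} else 0)"
proof -
  have bij: "bij_betw (\<lambda>u. {v, u}) {u \<in> V. {v, u} \<in> E} {e \<in> E. v \<in> e}"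
  proof (intro bij_betwI' conjI)
    fix u u' assume "u \<in> {u \<in> V. {v, u} \<in> E}" "u' \<in> {u \<in> V. {v, u} \<in> E}"
    show "{v, u} = {v, u'} \<longleftrightarrow> u = u'" by (auto simp: doubleton_eq_iff)
  next
    fix e assume e: "e \<in> {e \<in> E. v \<in> e}"
    then obtain a b where "e = {a, b}" "a \<noteq> b" "a \<in> V" "b \<in> V"
      using simple_graph_edgeE[OF G] by blast
    with e show "\<exists>u\<in>{u \<in> V. {v, u} \<in> E}. e = {v, u}" by (auto simp: insert_commute)
  qed auto
  have "(\<Sum>e | e \<in> E \<and> v \<in> e. g e) = (\<Sum>u | u \<in> V \<and> {v, u} \<in> E. g {v, u})"
    using sum.reindex_bij_betw[OF bij, of g] by simp
  then show ?thesis by (simp add: sum.inter_filter[OF finite_simple_graph(1)[OF G]])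
qed

text \<open>The elimination run backwards: a positive solution \<open>w\<close> of the linear system
  is turned into a positive vector \<open>y\<close> satisfying the hypergraph equations.\<close>

lemma is_largest_H_eigenvalue_if_linear_eigenvector:
  fixes w :: "'a \<Rightarrow> real" and l :: real
  assumes G: "simple_graph V E" "V \<noteq> {}" and k: "2 * s < k" and s: "1 \<le> s"
    and l: "l > 1" and w: "\<And>v. v \<in> V \<Longrightarrow> w v > 0"
    and c: "c = (l - 1) powr (1 - real k / (2 * real s))"
    and eq: "\<And>v. v \<in> V \<Longrightarrow> real (card {e \<in> E. v \<in> e}) * w v +
      c * (\<Sum>u\<in>V. (if {v, u} \<in> E then 1 else 0) * w u) = l * w v"
  shows "is_largest_H_eigenvalue k (graph_index V E) (power_B E k s) l"
    and "is_largest_H_eigenvalue k (power_vertices V E k s) (power_Q E k s) l"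
proof -
  define y where "y i = (case i of
      Inl e \<Rightarrow> (\<Prod>v\<in>e. w v) powr (1 / k) * (l - 1) powr (- 1 / (2 * s))
    | Inr v \<Rightarrow> w v powr (2 / k))" for i
  have k0: "k > 0" using k by simp
  have W: "(\<Prod>v\<in>e. w v) > 0" if "e \<in> E" for e
    using that w G by (intro prod_pos) (auto simp: simple_graph_def)
  \<comment> \<open>The exponents of \<open>w\<close> add up to
    \<open>2s/k + (k - 2s)/k = 1\<close>, and those of \<open>l - 1\<close> give exactly
    \<open>c\<close>.\<close>
  have p: "(\<Prod>v\<in>e. y (Inr v)) ^ s * y (Inl e) ^ (k - 2 * s) = c * (\<Prod>v\<in>e. w v)"
    if e: "e \<in> E" for e
  proof -
    have "(\<Prod>v\<in>e. y (Inr v)) ^ s = (\<Prod>v\<in>e. w v) powr (s * (2 / k))"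
      using W[OF e] by (simp add: y_def prod_powr_distrib[symmetric] powr_power)
    moreover have "y (Inl e) ^ (k - 2 * s) = (\<Prod>v\<in>e. w v) powr (real (k - 2 * s) * (1 / k)) *
        (l - 1) powr (real (k - 2 * s) * (- 1 / (2 * s)))"
      using W[OF e] l by (simp add: y_def power_mult_distrib powr_power)
    moreover have "real (k - 2 * s) * (- 1 / (2 * s)) = 1 - real k / (2 * real s)"
      using k s by (simp add: of_nat_diff field_simps)
    moreover have "s * (2 / k) + real (k - 2 * s) * (1 / k) = 1"
      using k s by (simp add: of_nat_diff field_simps)
    ultimately show ?thesis
      using W[OF e] by (simp add: c powr_add[symmetric] mult.assoc[symmetric] mult.commute)
  qed
  have y_pos: "y i > 0" if "i \<in> graph_index V E" for i
    using that w W l by (cases i) (auto simp: y_def graph_index_def less_imp_neq[symmetric])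
  have y_eq: "card {e \<in> E. incident i e} * y i ^ k +
      (\<Sum>e | e \<in> E \<and> incident i e. (\<Prod>v\<in>e. y (Inr v)) ^ s * y (Inl e) ^ (k - 2 * s)) = l * y i ^ k"
    if i: "i \<in> graph_index V E" for i
  proof (cases i)
    case (Inl e)
    then have e: "e \<in> E" using i by (auto simp: graph_index_def)
    have one: "{e' \<in> E. incident i e'} = {e}" using e Inl by auto
    have "y i ^ k = (\<Prod>v\<in>e. w v) * (l - 1) powr (- (real k / (2 * s)))"
      using W[OF e] l k0 by (simp add: Inl y_def power_mult_distrib powr_power)
    \<comment> \<open>With a single incident edge, the equation at an edge index says
      \<open>(l - 1) * y i ^ k = c * (\<Prod>v\<in>e. w v)\<close>.\<close>
    then have "(l - 1) * y i ^ k = (\<Prod>v\<in>e. w v) * ((l - 1) * (l - 1) powr (- (real k / (2 * s))))"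
      by simp
    also have "\<dots> = c * (\<Prod>v\<in>e. w v)" using l by (simp add: c powr_mult_base)
    finally show ?thesis by (simp add: one p[OF e] left_diff_distrib)
  next
    case (Inr v)
    then have v: "v \<in> V" using i by (auto simp: graph_index_def)
    have y2: "y i ^ k = w v * w v"
      using w[OF v] k0 by (simp add: Inr y_def powr_power powr_numeral power2_eq_square)
    have "(\<Sum>e | e \<in> E \<and> incident i e. (\<Prod>v\<in>e. y (Inr v)) ^ s * y (Inl e) ^ (k - 2 * s)) =
      (\<Sum>e | e \<in> E \<and> v \<in> e. c * (\<Prod>u\<in>e. w u))"
      by (intro sum.cong) (auto simp: Inr p)
    also have "\<dots> = (\<Sum>u\<in>V. if {v, u} \<in> E then c * (\<Prod>u\<in>{v, u}. w u) else 0)"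
      by (rule sum_incident_edges_eq_sum_adjacent[OF G(1) v])
    also have "\<dots> = (\<Sum>u\<in>V. w v * (c * ((if {v, u} \<in> E then 1 else 0) * w u)))"
    proof (intro sum.cong refl)
      fix u
      \<comment> \<open>Without loops, the product over \<open>{v, u}\<close> really has two
        factors.\<close>
      have "u \<noteq> v" if "{v, u} \<in> E" using simple_graph_edgeE[OF G(1) that] by (metis doubleton_eq_iff)
      then show "(if {v, u} \<in> E then c * (\<Prod>u\<in>{v, u}. w u) else 0) =
        w v * (c * ((if {v, u} \<in> E then 1 else 0) * w u))" by auto
    qed
    also have "\<dots> = w v * (c * (\<Sum>u\<in>V. (if {v, u} \<in> E then 1 else 0) * w u))"
      by (simp add: sum_distrib_left)
    finally have S: "(\<Sum>e | e \<in> E \<and> incident i e. (\<Prod>v\<in>e. y (Inr v)) ^ s * y (Inl e) ^ (k - 2 * s)) =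
      w v * (c * (\<Sum>u\<in>V. (if {v, u} \<in> E then 1 else 0) * w u))" .
    have d: "{e \<in> E. incident i e} = {e \<in> E. v \<in> e}" by (simp add: Inr)
    \<comment> \<open>The equation at a vertex index is the linear one multiplied by
      \<open>w v\<close>.\<close>
    have "w v * (real (card {e \<in> E. v \<in> e}) * w v +
      c * (\<Sum>u\<in>V. (if {v, u} \<in> E then 1 else 0) * w u)) = w v * (l * w v)"
      by (simp only: eq[OF v])
    then show ?thesis unfolding S unfolding y2 d by (simp add: algebra_simps)
  qed
  show "is_largest_H_eigenvalue k (graph_index V E) (power_B E k s) l"
    "is_largest_H_eigenvalue k (power_vertices V E k s) (power_Q E k s) l"
    using is_largest_H_eigenvalue_power_B_power_Q[OF G k s y_pos y_eq] by auto
qed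

section \<open>Solving the linear systems and comparing their eigenvalues\<close>

lemma connected_graph_ex_degree_ge_2:
  assumes G: "simple_graph V E" "graph_connected V E" and card: "card V > 2"
  obtains v where "v \<in> V" "card {e \<in> E. v \<in> e} \<ge> 2"
proof (rule ccontr)
  note thesisI = that
  assume neg: "\<not> thesis"
  let ?R = "{(a, b). {a, b} \<in> E}"
  \<comment> \<open>If all degrees are at most one, edges that share a vertex coincide.\<close>
  have eq: "e = e'" if "e \<in> E" "e' \<in> E" "v \<in> e" "v \<in> e'" for v e e'
  proof (rule ccontr)
    assume "e \<noteq> e'"
    then have "card {e, e'} = 2" by simp
    moreover have "card {e, e'} \<le> card {e \<in> E. v \<in> e}"
      using that finite_simple_graph(2)[OF G(1)] by (intro card_mono) auto
    moreover have "v \<in> V" using that G(1) by (auto simp: simple_graph_def)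
    ultimately show False using neg thesisI[of v] by simp
  qed
  obtain v where v: "v \<in> V" using G(2) by (auto simp: graph_connected_def)
  have conn: "(v, x) \<in> ?R\<^sup>*" if "x \<in> V" for x using G(2) v that by (auto simp: graph_connected_def)
  have "\<not> V \<subseteq> {v}" using card card_mono[of "{v}" V] by auto
  then obtain x where x: "x \<in> V" "x \<noteq> v" by auto
  from conn[OF x(1)] x(2) obtain u where u: "{v, u} \<in> E"
    by (auto elim: converse_rtranclE)
  \<comment> \<open>A walk starting at \<open>v\<close> can then never leave the edge
    \<open>{v, u}\<close>, so connectedness leaves room for two vertices only.\<close>
  have "x \<in> {v, u}" if "x \<in> V" for x
    using conn[OF that]
  proof (induction rule: rtrancl_induct)
    case (step a b)
    then have "{a, b} = {v, u}" using u by (intro eq[of _ _ a]) auto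
    then show ?case by auto
  qed simp
  then have "card V \<le> card {v, u}" by (intro card_mono) auto
  also have "\<dots> \<le> 2" by (simp add: card_insert_if)
  finally show False using card by simp
qed

text \<open>The self-consistent Perron result applies from \<open>l0 = 2\<close> on: some degree is
  at least 2, and \<open>(l - 1) powr b\<close> is bounded by 1 there because \<open>b < 0\<close>.
  The bound \<open>l > 2\<close> is strict so that powers of \<open>l - 1\<close> strictly increase
  with the exponent.\<close>

lemma ex_linear_eigenvector:
  assumes G: "simple_graph V E" "graph_connected V E" and card: "card V > 2" and "b < (0::real)"
  obtains l w where "l > (2::real)" "\<And>v. v \<in> V \<Longrightarrow> w v > (0::real)"
    "\<And>v. v \<in> V \<Longrightarrow> real (card {e \<in> E. v \<in> e}) * w v +
      (l - 1) powr b * (\<Sum>u\<in>V. (if {v, u} \<in> E then 1 else 0) * w u) = l * w v"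
proof -
  define a where "a v u = (if {v, u} \<in> E then 1 else (0::real))" for v u
  obtain v0 where v0: "v0 \<in> V" "card {e \<in> E. v0 \<in> e} \<ge> 2"
    using connected_graph_ex_degree_ge_2[OF G card] .
  have R: "{(x, y). x \<in> V \<and> y \<in> V \<and> a x y > 0} = {(x, y). {x, y} \<in> E}"
    using G(1) by (auto simp: a_def simple_graph_def split: if_splits)
  obtain l w where l: "l \<ge> 2" and w: "\<And>v. v \<in> V \<Longrightarrow> w v > 0"
    and eq: "\<And>v. v \<in> V \<Longrightarrow> real (card {e \<in> E. v \<in> e}) * w v +
      (l - 1) powr b * (\<Sum>u\<in>V. a v u * w u) = l * w v"
  proof (rule self_consistent_Perron_eigenvector[of V a 2 "\<lambda>l. (l - 1) powr b" 1 v0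
        "\<lambda>v. real (card {e \<in> E. v \<in> e})"])
    show "(u, v) \<in> {(x, y). x \<in> V \<and> y \<in> V \<and> a x y > 0}\<^sup>*" if "u \<in> V" "v \<in> V" for u v
      unfolding R using G(2) that by (auto simp: graph_connected_def)
    show "continuous_on {2..} (\<lambda>l. (l - 1) powr b)"
      by (intro continuous_intros) auto
    show "0 < (l - 1) powr b \<and> (l - 1) powr b \<le> 1" if "2 \<le> l" for l
      using that powr_mono[of b 0 "l - 1"] \<open>b < 0\<close> by auto
  qed (use v0 finite_simple_graph(1)[OF G(1)] in \<open>auto simp: a_def insert_commute\<close>)
  \<comment> \<open>A neighbour \<open>u0\<close> of \<open>v0\<close> contributes a positive amount
    to the equation at \<open>v0\<close>, which pushes \<open>l\<close> strictly above the degree of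
    \<open>v0\<close>.\<close>
  have "{e \<in> E. v0 \<in> e} \<noteq> {}" using v0(2) by (metis card.empty not_numeral_le_zero)
  then obtain e where e: "e \<in> E" "v0 \<in> e" by blast
  obtain x y where xy: "e = {x, y}" "x \<in> V" "y \<in> V" using simple_graph_edgeE[OF G(1) e(1)] .
  obtain u0 where u0: "{v0, u0} \<in> E" "u0 \<in> V"
    using e xy by (cases "v0 = x") (auto simp: insert_commute)
  have "a v0 u0 * w u0 \<le> (\<Sum>u\<in>V. a v0 u * w u)"
    using u0 w finite_simple_graph(1)[OF G(1)]
    by (intro member_le_sum) (auto simp: a_def less_imp_le)
  then have "(\<Sum>u\<in>V. a v0 u * w u) > 0" using u0 w[of u0] by (simp add: a_def)
  then have "(l - 1) powr b * (\<Sum>u\<in>V. a v0 u * w u) > 0" using l by simp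
  then have "real (card {e \<in> E. v0 \<in> e}) * w v0 < l * w v0" using eq[OF v0(1)] by linarith
  then have "l > 2" using w[OF v0(1)] v0(2) by auto
  then show ?thesis using that w eq unfolding a_def by blast
qed

text \<open>Pair each system with the solution of the other and subtract. By symmetry the diagonal
  terms cancel and \<open>l - l'\<close> times the inner product of \<open>w\<close> and
  \<open>w'\<close> equals \<open>(c - c') * S\<close>, where the mixed form \<open>S\<close> is
  positive.\<close>

lemma linear_eigenvalue_less:
  fixes l l' :: real and w w' :: "'a \<Rightarrow> real"
  assumes V: "finite V" "V \<noteq> {}" and E: "\<exists>u\<in>V. \<exists>v\<in>V. a v u > 0"
    and a: "\<And>u v. a u v \<ge> 0" "\<And>u v. a u v = a v u"
    and w: "\<And>v. v \<in> V \<Longrightarrow> w v > 0" "\<And>v. v \<in> V \<Longrightarrow> w' v > 0"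
    and eq: "\<And>v. v \<in> V \<Longrightarrow> d v * w v + c * (\<Sum>u\<in>V. a v u * w u) = l * w v"
      "\<And>v. v \<in> V \<Longrightarrow> d v * w' v + c' * (\<Sum>u\<in>V. a v u * w' u) = l' * w' v"
    and c: "c' < c"
  shows "l' < l"
proof -
  define S where "S = (\<Sum>v\<in>V. \<Sum>u\<in>V. w' v * (a v u * w u))"
  have S': "S = (\<Sum>v\<in>V. \<Sum>u\<in>V. w v * (a v u * w' u))"
    unfolding S_def by (subst sum.swap) (simp add: a(2) mult_ac)
  have 1: "l * (\<Sum>v\<in>V. w v * w' v) = (\<Sum>v\<in>V. d v * (w v * w' v)) + c * S"
  proof -
    have "l * (\<Sum>v\<in>V. w v * w' v) = (\<Sum>v\<in>V. w' v * (l * w v))"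
      by (simp add: sum_distrib_left mult_ac)
    also have "\<dots> = (\<Sum>v\<in>V. w' v * (d v * w v + c * (\<Sum>u\<in>V. a v u * w u)))"
      using eq(1) by (intro sum.cong) auto
    finally show ?thesis by (simp add: S_def distrib_left sum.distrib sum_distrib_left mult_ac)
  qed
  have 2: "l' * (\<Sum>v\<in>V. w v * w' v) = (\<Sum>v\<in>V. d v * (w v * w' v)) + c' * S"
  proof -
    have "l' * (\<Sum>v\<in>V. w v * w' v) = (\<Sum>v\<in>V. w v * (l' * w' v))"
      by (simp add: sum_distrib_left mult_ac)
    also have "\<dots> = (\<Sum>v\<in>V. w v * (d v * w' v + c' * (\<Sum>u\<in>V. a v u * w' u)))"
      using eq(2) by (intro sum.cong) auto
    finally show ?thesis by (simp add: S' distrib_left sum.distrib sum_distrib_left mult_ac)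
  qed
  obtain u v where uv: "u \<in> V" "v \<in> V" "a v u > 0" using E by blast
  have "0 < w' v * (a v u * w u)" using uv w by simp
  also have "\<dots> \<le> (\<Sum>u\<in>V. w' v * (a v u * w u))"
    using uv V w a(1) by (intro member_le_sum) (auto simp: less_imp_le)
  also have "\<dots> \<le> S"
    unfolding S_def using uv V w a(1)
    by (intro member_le_sum[of v V "\<lambda>v. \<Sum>u\<in>V. w' v * (a v u * w u)"])
      (auto intro!: sum_nonneg mult_nonneg_nonneg simp: less_imp_le)
  finally have "c' * S < c * S" using c by simp
  with 1 2 have "l' * (\<Sum>v\<in>V. w v * w' v) < l * (\<Sum>v\<in>V. w v * w' v)" by linarith
  moreover have "(\<Sum>v\<in>V. w v * w' v) > 0" using V w by (intro sum_pos) auto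
  ultimately show ?thesis by simp
qed

text \<open>\<open>largest_H_eigenvalue\<close> is a definite description, so the first conjunct
  also asserts that both maxima exist; the equality then relates genuine eigenvalues.\<close>

theorem theorem4p5:
  fixes V :: "'a set" and E :: "'a set set" and s :: nat
  assumes "simple_graph V E" and "graph_connected V E" and "card V > 2" and "1 \<le> s"
  shows "(\<forall>k. 2 < k \<and> 2 * s < k \<longrightarrow>
            is_largest_H_eigenvalue k (graph_index V E) (power_B E k s) (lambda_B V E k s) \<and>
            is_largest_H_eigenvalue k (power_vertices V E k s) (power_Q E k s) (lambda_Q V E k s) \<and>
            lambda_B V E k s = lambda_Q V E k s) \<and>
         (\<forall>k k'. 2 < k \<and> 2 * s < k \<and> k < k' \<longrightarrow> lambda_Q V E k' s < lambda_Q V E k s)"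
proof -
  note G = assms(1,2)
  have V: "finite V" "V \<noteq> {}" using assms(3) finite_simple_graph(1)[OF G(1)] by auto
  define a where "a v u = (if {v, u} \<in> E then 1 else (0::real))" for v u
  define b where "b k = 1 - real k / (2 * real s)" for k
  have b_neg: "b k < 0" if "2 * s < k" for k
  proof -
    have "2 * real s < real k" using that by (metis of_nat_less_iff of_nat_mult of_nat_numeral)
    then show ?thesis using assms(4) by (simp add: b_def field_simps)
  qed
  \<comment> \<open>The bound and the linear eigenvector are kept besides the claims for a single
    \<open>k\<close>, since comparing two values of \<open>k\<close> relies on them.\<close>
  have main: "lambda_Q V E k s > 2 \<and>
      is_largest_H_eigenvalue k (graph_index V E) (power_B E k s) (lambda_B V E k s) \<and>
      is_largest_H_eigenvalue k (power_vertices V E k s) (power_Q E k s) (lambda_Q V E k s) \<and>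
      lambda_B V E k s = lambda_Q V E k s \<and>
      (\<exists>w. (\<forall>v\<in>V. w v > 0) \<and> (\<forall>v\<in>V. real (card {e \<in> E. v \<in> e}) * w v +
        (lambda_Q V E k s - 1) powr b k * (\<Sum>u\<in>V. a v u * w u) = lambda_Q V E k s * w v))"
    if k: "2 * s < k" for k
  proof -
    obtain l w where l: "l > 2" and w: "\<And>v. v \<in> V \<Longrightarrow> w v > 0"
      and eq: "\<And>v. v \<in> V \<Longrightarrow> real (card {e \<in> E. v \<in> e}) * w v +
        (l - 1) powr b k * (\<Sum>u\<in>V. (if {v, u} \<in> E then 1 else 0) * w u) = l * w v"
      using ex_linear_eigenvector[OF G assms(3) b_neg[OF k]] by blast
    have "l > 1" using l by simp
    note largest = is_largest_H_eigenvalue_if_linear_eigenvector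
      [OF G(1) V(2) k assms(4) this w refl eq[unfolded b_def]]
    have lambda: "lambda_B V E k s = l" "lambda_Q V E k s = l"
      by (simp_all only: lambda_B_def lambda_Q_def largest_H_eigenvalue_eq[OF largest(1)]
          largest_H_eigenvalue_eq[OF largest(2)])
    show ?thesis
      unfolding lambda using l w eq largest by (intro conjI exI[of _ w]) (simp_all add: a_def)
  qed
  have "lambda_Q V E k' s < lambda_Q V E k s" if k: "2 * s < k" "k < k'" for k k'
  proof (rule ccontr)
    assume neg: "\<not> ?thesis"
    have l: "lambda_Q V E k s > 2" using main[OF k(1)] by blast
    obtain w where w: "\<forall>v\<in>V. w v > 0"
      and eq: "\<forall>v\<in>V. real (card {e \<in> E. v \<in> e}) * w v +
        (lambda_Q V E k s - 1) powr b k * (\<Sum>u\<in>V. a v u * w u) = lambda_Q V E k s * w v"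
      using main[OF k(1)] by blast
    obtain w' where w': "\<forall>v\<in>V. w' v > 0"
      and eq': "\<forall>v\<in>V. real (card {e \<in> E. v \<in> e}) * w' v +
        (lambda_Q V E k' s - 1) powr b k' * (\<Sum>u\<in>V. a v u * w' u) = lambda_Q V E k' s * w' v"
      using main[OF less_trans[OF k]] by blast
    \<comment> \<open>Assuming the eigenvalue at \<open>k'\<close> is no smaller,
      \<open>c' < c\<close> follows in two moves: raise the exponent from \<open>b k'\<close> to
      \<open>b k\<close> over a base above 1, then lower the base, which cannot decrease a power
      with negative exponent.\<close>
    have "b k' < b k" using k assms(4) by (simp add: b_def divide_strict_right_mono)
    then have "(lambda_Q V E k' s - 1) powr b k' < (lambda_Q V E k' s - 1) powr b k"
      using neg l by (intro powr_less_mono) auto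
    also have "\<dots> \<le> (lambda_Q V E k s - 1) powr b k"
      using neg l b_neg[OF k(1)] by (intro powr_mono2') auto
    finally have c: "(lambda_Q V E k' s - 1) powr b k' < (lambda_Q V E k s - 1) powr b k" .
    obtain v where v: "v \<in> V" "card {e \<in> E. v \<in> e} \<ge> 2"
      using connected_graph_ex_degree_ge_2[OF G assms(3)] .
    then have "{e \<in> E. v \<in> e} \<noteq> {}" by (metis card.empty not_numeral_le_zero)
    then obtain e where e: "e \<in> E" by blast
    obtain x y where "e = {x, y}" "x \<in> V" "y \<in> V" using simple_graph_edgeE[OF G(1) e] .
    with e have "{x, y} \<in> E" "x \<in> V" "y \<in> V" by auto
    then have edge: "\<exists>u\<in>V. \<exists>v\<in>V. a v u > 0" by (auto simp: a_def)
    have "lambda_Q V E k' s < lambda_Q V E k s"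
    proof (rule linear_eigenvalue_less[OF V edge _ _ _ _ _ _ c,
          where w = w and w' = w' and d = "\<lambda>v. real (card {e \<in> E. v \<in> e})"])
      show "a u v \<ge> 0" "a u v = a v u" for u v by (auto simp: a_def insert_commute)
    qed (use w w' eq eq' in auto)
    with neg show False by simp
  qed
  moreover have "is_largest_H_eigenvalue k (graph_index V E) (power_B E k s) (lambda_B V E k s) \<and>
    is_largest_H_eigenvalue k (power_vertices V E k s) (power_Q E k s) (lambda_Q V E k s) \<and>
    lambda_B V E k s = lambda_Q V E k s" if "2 * s < k" for k
    using main[OF that] by blast
  ultimately show ?thesis by blast
qed

end
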